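(* If a tropical polynomial $f$ of one variable over $\mathbb{K}$ is computed by a tropical formula $C$, then the number of roots of $f$ satisfies $\# f\le|C|$.
   Context: $\mathbb{K}$ is $\mathbb{R}$ or $\mathbb{Q}$, with tropical addition $x\oplus y=\max(x,y)$ and tropical multiplication $x\odot y=x+y$. A tropical polynomial of one variable is a finite nonempty collection of tropical monomials $c_i+i x$ with distinct nonnegative integer exponents $i$ and constants $c_i\in\mathbb{K}$, with value the maximum of its monomials (monomials with the same exponent are merged by taking the maximal constant). A point $a\in\mathbb{K}$ is a root if the maximum at $a$ is attained on at least two distinct monomials; equivalently, $a$ is a point of non-smoothness of the piecewise linear convex function. $\# f$ denotes the number of roots of $f$. A tropical circuit is a directed acyclic graph each vertex (gate) of which has in-degree $0$ or $2$; gates of in-degree $0$ are labeled by a variable or a constant of $\mathbb{K}$, gates of in-degree $2$ are labeled by $\oplus$ or $\odot$. Each gate computes a tropical polynomial defined inductively in the natural way; one gate is the output gate, and the circuit computes the polynomial of the output gate. The size $|C|$ is the number of gates. A tropical formula is a tropical circuit in which every non-output gate has out-degree $1$. *)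

theory Defs
  imports Complex_Main "Graph_Theory.Digraph"
begin

text \<open>
  Both ground sets are treated as subsets of the reals: \<open>K\<close> is \<open>\<real>\<close> (all of the type) or \<open>\<rat>\<close>.
\<close>

section \<open>Tropical polynomials in one variable\<close>

text \<open>
  A tropical polynomial is a formal object: \<open>f i = Some c\<close> means that the monomial \<open>c + i x\<close>
  belongs to \<open>f\<close>, and \<open>f i = None\<close> that there is no monomial with exponent \<open>i\<close>. Monomials that
  never attain the maximum are kept.
\<close>

type_synonym trop_poly = "nat \<rightharpoonup> real"

definition tropical_polynomial :: "real set \<Rightarrow> trop_poly \<Rightarrow> bool" where
  "tropical_polynomial K f \<longleftrightarrow> finite (dom f) \<and> dom f \<noteq> {} \<and> ran f \<subseteq> K"

definition monomial_at :: "trop_poly \<Rightarrow> nat \<Rightarrow> real \<Rightarrow> real" where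
  "monomial_at f i a = the (f i) + real i * a"

definition trop_eval :: "trop_poly \<Rightarrow> real \<Rightarrow> real" where
  "trop_eval f a = Max ((\<lambda>i. monomial_at f i a) ` dom f)"

definition trop_roots :: "real set \<Rightarrow> trop_poly \<Rightarrow> real set" where
  "trop_roots K f = {a \<in> K. \<exists>i \<in> dom f. \<exists>j \<in> dom f. i \<noteq> j \<and>
     monomial_at f i a = trop_eval f a \<and> monomial_at f j a = trop_eval f a}"

definition trop_var :: trop_poly where
  "trop_var = [1 \<mapsto> 0]"

definition trop_const :: "real \<Rightarrow> trop_poly" where
  "trop_const c = [0 \<mapsto> c]"

definition trop_plus :: "trop_poly \<Rightarrow> trop_poly \<Rightarrow> trop_poly" where
  "trop_plus f g = (\<lambda>n. case (f n, g n) of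
     (Some a, Some b) \<Rightarrow> Some (max a b)
   | (Some a, None) \<Rightarrow> Some a
   | (None, r) \<Rightarrow> r)"

definition trop_times :: "trop_poly \<Rightarrow> trop_poly \<Rightarrow> trop_poly" where
  "trop_times f g = (\<lambda>n.
     let S = {the (f i) + the (g j) | i j. i \<in> dom f \<and> j \<in> dom g \<and> i + j = n}
     in if S = {} then None else Some (Max S))"


section \<open>Tropical circuits and formulas\<close>

datatype gate_label = Var | Const real | Oplus | Odot

text \<open>
  The underlying graph is a multidigraph, so that both inputs of a gate may come from the same
  gate; two such parallel arcs both count for the out-degree of that gate.
\<close>

record ('v, 'e) trop_circuit =
  dag :: "('v, 'e) pre_digraph"
  label :: "'v \<Rightarrow> gate_label"
  output_gate :: 'v

definition tropical_circuit :: "real set \<Rightarrow> ('v, 'e) trop_circuit \<Rightarrow> bool" where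
  "tropical_circuit K C \<longleftrightarrow>
     fin_digraph (dag C) \<and> acyclic (arcs_ends (dag C)) \<and> output_gate C \<in> verts (dag C) \<and>
     (\<forall>v \<in> verts (dag C).
        in_degree (dag C) v = 0 \<and> (label C v = Var \<or> (\<exists>c \<in> K. label C v = Const c)) \<or>
        in_degree (dag C) v = 2 \<and> (label C v = Oplus \<or> label C v = Odot))"

definition tropical_formula :: "real set \<Rightarrow> ('v, 'e) trop_circuit \<Rightarrow> bool" where
  "tropical_formula K C \<longleftrightarrow>
     tropical_circuit K C \<and>
     (\<forall>v \<in> verts (dag C). v \<noteq> output_gate C \<longrightarrow> out_degree (dag C) v = 1)"

definition circuit_size :: "('v, 'e) trop_circuit \<Rightarrow> nat" where
  "circuit_size C = card (verts (dag C))"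

inductive gate_computes :: "('v, 'e) trop_circuit \<Rightarrow> 'v \<Rightarrow> trop_poly \<Rightarrow> bool"
  for C :: "('v, 'e) trop_circuit" where
  var: "v \<in> verts (dag C) \<Longrightarrow> label C v = Var \<Longrightarrow> gate_computes C v trop_var"
| const: "v \<in> verts (dag C) \<Longrightarrow> label C v = Const c \<Longrightarrow> gate_computes C v (trop_const c)"
| oplus: "v \<in> verts (dag C) \<Longrightarrow> label C v = Oplus \<Longrightarrow>
    in_arcs (dag C) v = {d, e} \<Longrightarrow> d \<noteq> e \<Longrightarrow>
    gate_computes C (tail (dag C) d) f \<Longrightarrow> gate_computes C (tail (dag C) e) g \<Longrightarrow>
    gate_computes C v (trop_plus f g)"
| odot: "v \<in> verts (dag C) \<Longrightarrow> label C v = Odot \<Longrightarrow>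
    in_arcs (dag C) v = {d, e} \<Longrightarrow> d \<noteq> e \<Longrightarrow>
    gate_computes C (tail (dag C) d) f \<Longrightarrow> gate_computes C (tail (dag C) e) g \<Longrightarrow>
    gate_computes C v (trop_times f g)"

definition circuit_computes :: "('v, 'e) trop_circuit \<Rightarrow> trop_poly \<Rightarrow> bool" where
  "circuit_computes C f \<longleftrightarrow> gate_computes C (output_gate C) f"

text \<open>The relational semantics is total on circuits, and single-valued.\<close>

lemma gate_computes_total:
  assumes C: "tropical_circuit K C" and v: "v \<in> verts (dag C)"
  shows "\<exists>f. gate_computes C v f"
proof -
  interpret fin_digraph "dag C" using C by (simp add: tropical_circuit_def)
  have "finite (arcs_ends (dag C))" by (simp add: arcs_ends_def)
  moreover have "acyclic (arcs_ends (dag C))" using C by (simp add: tropical_circuit_def)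
  ultimately have "wf (arcs_ends (dag C))" by (rule finite_acyclic_wf)
  then show ?thesis using v
  proof (induction v rule: wf_induct_rule)
    case (less v)
    show ?case
    proof (cases "in_degree (dag C) v = 2")
      case True
      then obtain d e where de: "in_arcs (dag C) v = {d, e}" "d \<noteq> e"
        by (auto simp: in_degree_def card_2_iff)
      then have *: "d \<in> arcs (dag C)" "head (dag C) d = v" "e \<in> arcs (dag C)" "head (dag C) e = v"
        by (auto simp: in_arcs_def)
      then obtain f g where "gate_computes C (tail (dag C) d) f" "gate_computes C (tail (dag C) e) g"
        using less.IH[of "tail (dag C) d"] less.IH[of "tail (dag C) e"]
        by (force simp: arcs_ends_conv)
      moreover have "label C v = Oplus \<or> label C v = Odot"
        using C less.prems True by (auto simp: tropical_circuit_def)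
      ultimately show ?thesis
        using de less.prems gate_computes.oplus[of v C d e f g] gate_computes.odot[of v C d e f g]
        by blast
    next
      case False
      then have "label C v = Var \<or> (\<exists>c \<in> K. label C v = Const c)"
        using C less.prems by (auto simp: tropical_circuit_def)
      then show ?thesis
        using less.prems gate_computes.var[of v C] gate_computes.const[of v C] by blast
    qed
  qed
qed

lemma trop_plus_commute: "trop_plus f g = trop_plus g f"
proof
  fix n
  show "trop_plus f g n = trop_plus g f n"
    by (cases "f n"; cases "g n") (simp_all add: trop_plus_def max.commute)
qed

lemma trop_times_commute: "trop_times f g = trop_times g f"
proof -
  have le: "{the (f i) + the (g j) | i j. i \<in> dom f \<and> j \<in> dom g \<and> i + j = n} \<subseteq>
        {the (g i) + the (f j) | i j. i \<in> dom g \<and> j \<in> dom f \<and> i + j = n}"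
    for f g :: trop_poly and n
  proof
    fix x assume "x \<in> {the (f i) + the (g j) | i j. i \<in> dom f \<and> j \<in> dom g \<and> i + j = n}"
    then obtain i j where "x = the (f i) + the (g j)" "i \<in> dom f" "j \<in> dom g" "i + j = n"
      by blast
    then have "x = the (g j) + the (f i) \<and> j \<in> dom g \<and> i \<in> dom f \<and> j + i = n" by simp
    then show "x \<in> {the (g i) + the (f j) | i j. i \<in> dom g \<and> j \<in> dom f \<and> i + j = n}" by blast
  qed
  have "{the (f i) + the (g j) | i j. i \<in> dom f \<and> j \<in> dom g \<and> i + j = n} =
        {the (g i) + the (f j) | i j. i \<in> dom g \<and> j \<in> dom f \<and> i + j = n}" for n
    by (rule subset_antisym[OF le le])
  then show ?thesis unfolding trop_times_def by simp
qed

lemma gate_computes_unique: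
  "gate_computes C v f \<Longrightarrow> gate_computes C v g \<Longrightarrow> f = g"
proof (induction arbitrary: g rule: gate_computes.induct)
  case (var v)
  from var.prems var.hyps(2) show ?case by (cases rule: gate_computes.cases) simp_all
next
  case (const v c)
  from const.prems const.hyps(2) show ?case by (cases rule: gate_computes.cases) simp_all
next
  case (oplus v d e p q)
  from oplus.prems oplus.hyps(2) obtain d' e' p' q' where
      *: "in_arcs (dag C) v = {d', e'}" "g = trop_plus p' q'"
         "gate_computes C (tail (dag C) d') p'" "gate_computes C (tail (dag C) e') q'"
    by (cases rule: gate_computes.cases) simp_all
  then consider "d' = d" "e' = e" | "d' = e" "e' = d"
    using oplus.hyps(3) by (auto simp: doubleton_eq_iff)
  then show ?case
  proof cases
    case 1
    then show ?thesis using oplus.IH * by blast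
  next
    case 2
    then have "p = q'" "q = p'" using oplus.IH * by blast+
    then show ?thesis using *(2) by (simp add: trop_plus_commute[of q'])
  qed
next
  case (odot v d e p q)
  from odot.prems odot.hyps(2) obtain d' e' p' q' where
      *: "in_arcs (dag C) v = {d', e'}" "g = trop_times p' q'"
         "gate_computes C (tail (dag C) d') p'" "gate_computes C (tail (dag C) e') q'"
    by (cases rule: gate_computes.cases) simp_all
  then consider "d' = d" "e' = e" | "d' = e" "e' = d"
    using odot.hyps(3) by (auto simp: doubleton_eq_iff)
  then show ?case
  proof cases
    case 1
    then show ?thesis using odot.IH * by blast
  next
    case 2
    then have "p = q'" "q = p'" using odot.IH * by blast+
    then show ?thesis using *(2) by (simp add: trop_times_commute[of q'])
  qed
qed

end

theory Submission
  imports Defs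
begin

text \<open>
  The proof counts the linear pieces of a tropical polynomial instead of its roots. The slope of
  the piece of \<open>f\<close> to the right of \<open>a\<close>, i.e. the right derivative of the piecewise linear function,
  is the largest exponent that attains the maximum at \<open>a\<close>. It is a nondecreasing function of \<open>a\<close>
  with finitely many values, and it jumps exactly at the roots, so there are fewer roots than
  slopes (\<open>card_trop_roots_less\<close>).

  The number of slopes is subadditive under both operations. Every piece of \<open>f \<oplus> g\<close> is part of a
  piece of \<open>f\<close> or of \<open>g\<close>, so its slopes already occur there (\<open>range_slope_plus\<close>). The slope of
  \<open>f \<odot> g\<close> is the sum of the slopes of its factors (\<open>slope_times\<close>), and a sum of two nondecreasing
  functions with \<open>p\<close> and \<open>q\<close> values has at most \<open>p + q\<close> values, because its values can be
  ranked by how far the two summands have moved (\<open>card_range_add_le\<close>).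

  In a formula, the gates below the two inputs of a gate form disjoint sets
  (\<open>disjoint_ancestors\<close>): no gate has two ways to the output, as every gate other than the output
  has a single outgoing arc. Starting from one slope at each leaf, induction thus bounds
  the number of slopes at a gate by the number of gates below it.
\<close>

section \<open>Slopes of tropical polynomials\<close>

definition slope :: "trop_poly \<Rightarrow> real \<Rightarrow> nat" where
  "slope f a = Max {i \<in> dom f. monomial_at f i a = trop_eval f a}"

lemma monomial_le_eval:
  assumes "finite (dom f)" "i \<in> dom f"
  shows "monomial_at f i a \<le> trop_eval f a"
  using assms unfolding trop_eval_def by (intro Max_ge) auto

lemma slope_attains:
  assumes "finite (dom f)" "dom f \<noteq> {}"
  shows "slope f a \<in> dom f" "monomial_at f (slope f a) a = trop_eval f a"
proof -
  have "trop_eval f a \<in> (\<lambda>i. monomial_at f i a) ` dom f"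
    unfolding trop_eval_def using assms by (intro Max_in) auto
  then have "{i \<in> dom f. monomial_at f i a = trop_eval f a} \<noteq> {}" by auto
  then have "slope f a \<in> {i \<in> dom f. monomial_at f i a = trop_eval f a}"
    unfolding slope_def using assms(1) by (intro Max_in) auto
  then show "slope f a \<in> dom f" "monomial_at f (slope f a) a = trop_eval f a" by auto
qed

lemma le_slope:
  assumes "finite (dom f)" "i \<in> dom f" "monomial_at f i a = trop_eval f a"
  shows "i \<le> slope f a"
  using assms unfolding slope_def by (intro Max_ge) auto

lemma monomial_less_slope:
  assumes "finite (dom f)" "dom f \<noteq> {}" "i \<in> dom f" "slope f a < i"
  shows "monomial_at f i a < monomial_at f (slope f a) a"
  using monomial_le_eval[OF assms(1,3), of a] le_slope[OF assms(1,3), of a]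
    slope_attains(2)[OF assms(1,2), of a] assms(4) by linarith

lemma slope_eqI:
  assumes fin: "finite (dom f)" and i: "i \<in> dom f"
    and le: "\<And>j. j \<in> dom f \<Longrightarrow> monomial_at f j a \<le> monomial_at f i a"
    and less: "\<And>j. j \<in> dom f \<Longrightarrow> i < j \<Longrightarrow> monomial_at f j a < monomial_at f i a"
  shows "slope f a = i"
proof -
  have ne: "dom f \<noteq> {}" using i by auto
  have eq: "monomial_at f i a = trop_eval f a"
    using le[OF slope_attains(1)[OF fin ne, of a]] slope_attains(2)[OF fin ne, of a]
      monomial_le_eval[OF fin i, of a] by simp
  then have "i \<le> slope f a" by (rule le_slope[OF fin i])
  moreover have "\<not> i < slope f a"
    using less[OF slope_attains(1)[OF fin ne, of a]] slope_attains(2)[OF fin ne, of a] eq by auto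
  ultimately show ?thesis by simp
qed

text \<open>
  Going left from \<open>a\<close>, a steeper monomial falls faster than a monomial that is maximal at \<open>a\<close>, so
  it stays strictly below it.
\<close>

lemma slope_le_left:
  assumes fin: "finite (dom f)" and i: "i \<in> dom f" "monomial_at f i a = trop_eval f a"
    and "b < a"
  shows "slope f b \<le> i"
proof (rule ccontr)
  assume "\<not> slope f b \<le> i"
  then have "real i * (a - b) < real (slope f b) * (a - b)" using \<open>b < a\<close> by simp
  moreover have ne: "dom f \<noteq> {}" using i by auto
  moreover have "monomial_at f i b \<le> monomial_at f (slope f b) b"
    using monomial_le_eval[OF fin i(1)] slope_attains(2)[OF fin ne] by simp
  ultimately have "monomial_at f i a < monomial_at f (slope f b) a"
    by (simp add: monomial_at_def algebra_simps)
  then show False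
    using monomial_le_eval[OF fin slope_attains(1)[OF fin ne], of b a] i(2) by simp
qed

lemma mono_slope:
  assumes "finite (dom f)" "dom f \<noteq> {}"
  shows "mono (slope f)"
proof (rule monoI)
  fix b a :: real assume "b \<le> a"
  then show "slope f b \<le> slope f a"
    using slope_le_left[OF assms(1) slope_attains[OF assms]] by (cases "b = a") auto
qed

lemma finite_range_slope:
  assumes "finite (dom f)" "dom f \<noteq> {}"
  shows "finite (range (slope f))"
  using slope_attains(1)[OF assms] assms(1) by (blast intro: finite_subset)

lemma slope_less_at_root:
  assumes fin: "finite (dom f)" and "a \<in> trop_roots K f" and "b < a"
  shows "slope f b < slope f a"
proof -
  obtain i j where "i \<in> dom f" "j \<in> dom f" "i < j"
    "monomial_at f i a = trop_eval f a" "monomial_at f j a = trop_eval f a"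
    using assms(2) unfolding trop_roots_def by (auto simp: neq_iff)
  then have "slope f b \<le> i" "j \<le> slope f a"
    using slope_le_left[OF fin] le_slope[OF fin] \<open>b < a\<close> by auto
  then show ?thesis using \<open>i < j\<close> by simp
qed

text \<open>
  Distinct roots are followed by distinct slopes, and the slope before the first root follows
  none of them.
\<close>

lemma card_trop_roots_less:
  assumes "finite (dom f)" "dom f \<noteq> {}"
  shows "finite (trop_roots K f)" "card (trop_roots K f) < card (range (slope f))"
proof -
  let ?R = "trop_roots K f"
  have fin: "finite (range (slope f))" by (rule finite_range_slope[OF assms])
  have inj: "inj_on (slope f) ?R"
    by (rule linorder_inj_onI') (use slope_less_at_root[OF assms(1)] in force)
  then show "finite ?R" using fin by (meson finite_imageD finite_subset image_mono subset_UNIV)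
  have "Min (range (slope f)) \<noteq> slope f a" if "a \<in> ?R" for a
  proof -
    have "Min (range (slope f)) \<le> slope f (a - 1)" using fin by (intro Min_le) auto
    also have "\<dots> < slope f a" using slope_less_at_root[OF assms(1) that] by simp
    finally show ?thesis by simp
  qed
  then have "Min (range (slope f)) \<notin> slope f ` ?R" by blast
  moreover have "Min (range (slope f)) \<in> range (slope f)" using fin by (intro Min_in) auto
  ultimately have "slope f ` ?R \<subset> range (slope f)" by blast
  then show "card ?R < card (range (slope f))"
    using psubset_card_mono[OF fin] card_image[OF inj] by metis
qed


section \<open>Slopes under the tropical operations\<close>

lemma dom_trop_plus: "dom (trop_plus f g) = dom f \<union> dom g"
  by (auto simp: trop_plus_def dom_def split: option.splits)

lemma dom_trop_times: "dom (trop_times f g) = {i + j | i j. i \<in> dom f \<and> j \<in> dom g}"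
  unfolding trop_times_def Let_def by (auto simp: dom_def split: if_splits)

lemma trop_plus_ge:
  assumes "i \<in> dom f"
  shows "monomial_at f i a \<le> monomial_at (trop_plus f g) i a"
  using assms by (auto simp: monomial_at_def trop_plus_def split: option.splits)

lemma finite_trop_times_coeffs:
  assumes "finite (dom f)" "finite (dom g)"
  shows "finite {the (f i) + the (g j) | i j. i \<in> dom f \<and> j \<in> dom g \<and> i + j = n}"
proof (rule finite_subset)
  show "{the (f i) + the (g j) | i j. i \<in> dom f \<and> j \<in> dom g \<and> i + j = n}
      \<subseteq> (\<lambda>(i, j). the (f i) + the (g j)) ` (dom f \<times> dom g)" by auto
qed (use assms in simp)

lemma trop_times_ge:
  assumes "finite (dom f)" "finite (dom g)" "i \<in> dom f" "j \<in> dom g"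
  shows "monomial_at f i a + monomial_at g j a \<le> monomial_at (trop_times f g) (i + j) a"
proof -
  let ?S = "{the (f i') + the (g j') | i' j'. i' \<in> dom f \<and> j' \<in> dom g \<and> i' + j' = i + j}"
  have S: "the (f i) + the (g j) \<in> ?S" using assms by blast
  then have "?S \<noteq> {}" by (metis empty_iff)
  then have "the (trop_times f g (i + j)) = Max ?S"
    unfolding trop_times_def Let_def by (simp only: if_False option.sel)
  moreover have "the (f i) + the (g j) \<le> Max ?S"
    by (rule Max_ge[OF finite_trop_times_coeffs[OF assms(1,2)] S])
  ultimately show ?thesis by (simp add: monomial_at_def algebra_simps)
qed

lemma trop_times_attained:
  assumes "finite (dom f)" "finite (dom g)" "n \<in> dom (trop_times f g)"
  obtains i j where "i \<in> dom f" "j \<in> dom g" "n = i + j"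
    "\<And>a. monomial_at (trop_times f g) n a = monomial_at f i a + monomial_at g j a"
proof -
  let ?S = "{the (f i') + the (g j') | i' j'. i' \<in> dom f \<and> j' \<in> dom g \<and> i' + j' = n}"
  have ne: "?S \<noteq> {}" and eq: "the (trop_times f g n) = Max ?S"
    using assms(3) unfolding trop_times_def Let_def domIff
    by (simp_all only: option.sel if_False split: if_splits) simp_all
  have "Max ?S \<in> ?S" by (rule Max_in[OF finite_trop_times_coeffs[OF assms(1,2)] ne])
  then obtain i j where "i \<in> dom f" "j \<in> dom g" "i + j = n" "Max ?S = the (f i) + the (g j)"
    by blast
  then show ?thesis using eq by (intro that[of i j]) (auto simp: monomial_at_def algebra_simps)
qed

text \<open>
  The monomial of \<open>f \<oplus> g\<close> that determines its slope has the coefficient of \<open>f\<close> or of \<open>g\<close>. In the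
  first case it beats all monomials of \<open>f\<close>, which lie below those of \<open>f \<oplus> g\<close>, so it also
  determines the slope of \<open>f\<close>.
\<close>

lemma slope_plus_inherited:
  assumes f: "finite (dom f)" and g: "finite (dom g)"
    and i: "i = slope (trop_plus f g) a" "i \<in> dom f" "trop_plus f g i = f i"
  shows "slope f a = i"
proof (rule slope_eqI[OF f i(2)])
  have fin: "finite (dom (trop_plus f g))" and ne: "dom (trop_plus f g) \<noteq> {}"
    using f g i(2) by (auto simp: dom_trop_plus)
  have same: "monomial_at f i a = monomial_at (trop_plus f g) i a"
    using i(3) by (simp add: monomial_at_def)
  fix j assume j: "j \<in> dom f"
  then have j': "j \<in> dom (trop_plus f g)" by (simp add: dom_trop_plus)
  show "monomial_at f j a \<le> monomial_at f i a"
    using trop_plus_ge[OF j, of a g] monomial_le_eval[OF fin j', of a]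
      slope_attains(2)[OF fin ne, of a] same i(1) by simp
  show "monomial_at f j a < monomial_at f i a" if "i < j"
    using trop_plus_ge[OF j, of a g] monomial_less_slope[OF fin ne j', of a] that same i(1)
    by simp
qed

lemma range_slope_plus:
  assumes f: "finite (dom f)" "dom f \<noteq> {}" and g: "finite (dom g)" "dom g \<noteq> {}"
  shows "range (slope (trop_plus f g)) \<subseteq> range (slope f) \<union> range (slope g)"
proof
  fix i assume "i \<in> range (slope (trop_plus f g))"
  then obtain a where a: "i = slope (trop_plus f g) a" by auto
  have "i \<in> dom f \<union> dom g"
    using slope_attains(1)[of "trop_plus f g" a] f g a by (auto simp: dom_trop_plus)
  then consider "i \<in> dom f" "trop_plus f g i = f i" | "i \<in> dom g" "trop_plus f g i = g i"
    by (cases "f i"; cases "g i"; cases "the (f i) \<le> the (g i)")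
      (auto simp: trop_plus_def max_def)
  then show "i \<in> range (slope f) \<union> range (slope g)"
  proof cases
    case 1
    then have "slope f a = i" by (rule slope_plus_inherited[OF f(1) g(1) a])
    then show ?thesis by blast
  next
    case 2
    then have "slope g a = i"
      using slope_plus_inherited[OF g(1) f(1), of i a] a by (simp add: trop_plus_commute[of g f])
    then show ?thesis by blast
  qed
qed

lemma slope_times:
  assumes f: "finite (dom f)" "dom f \<noteq> {}" and g: "finite (dom g)" "dom g \<noteq> {}"
  shows "slope (trop_times f g) a = slope f a + slope g a"
proof (rule slope_eqI)
  let ?i = "slope f a" and ?j = "slope g a"
  note i = slope_attains[OF f, of a] and j = slope_attains[OF g, of a]
  show "finite (dom (trop_times f g))" using f g by (simp add: dom_trop_times finite_image_set2)
  show "?i + ?j \<in> dom (trop_times f g)" using i j by (auto simp: dom_trop_times)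
  have ge: "monomial_at f ?i a + monomial_at g ?j a \<le> monomial_at (trop_times f g) (?i + ?j) a"
    using trop_times_ge f g i j by blast
  fix n assume "n \<in> dom (trop_times f g)"
  then obtain k l where kl: "k \<in> dom f" "l \<in> dom g" "n = k + l"
    "monomial_at (trop_times f g) n a = monomial_at f k a + monomial_at g l a"
    using trop_times_attained[OF f(1) g(1)] by metis
  have le: "monomial_at f k a \<le> monomial_at f ?i a" "monomial_at g l a \<le> monomial_at g ?j a"
    using monomial_le_eval f g kl i j by auto
  show "monomial_at (trop_times f g) n a \<le> monomial_at (trop_times f g) (?i + ?j) a"
    using kl le ge by simp
  assume "?i + ?j < n"
  then have "?i < k \<or> ?j < l" using kl by auto
  then have "monomial_at f k a < monomial_at f ?i a \<or> monomial_at g l a < monomial_at g ?j a"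
    using monomial_less_slope f g kl by blast
  then show "monomial_at (trop_times f g) n a < monomial_at (trop_times f g) (?i + ?j) a"
    using kl le ge by auto
qed

text \<open>
  Two different values of \<open>h + k\<close> are taken at points where, by monotonicity, neither summand
  decreases and at least one increases. The number of values that \<open>h\<close> and \<open>k\<close> have left behind
  therefore separates the values of \<open>h + k\<close>, and it is less than the total number of values.
\<close>

lemma card_range_add_le:
  fixes h k :: "'a::linorder \<Rightarrow> nat"
  assumes h: "mono h" "finite (range h)" and k: "mono k" "finite (range k)"
  shows "card (range (\<lambda>a. h a + k a)) \<le> card (range h) + card (range k)"
proof -
  let ?below = "\<lambda>h a. {x \<in> range h. x < (h a :: nat)}"
  define rank where "rank a = card (?below h a) + card (?below k a)" for a
  define pt where "pt s = (SOME a. h a + k a = s)" for s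
  have pt: "h (pt s) + k (pt s) = s" if "s \<in> range (\<lambda>a. h a + k a)" for s
    unfolding pt_def by (rule someI_ex) (use that in auto)
  have below_mono: "card (?below h a) \<le> card (?below h b)"
    if "finite (range h)" "h a \<le> h b" for h :: "'a \<Rightarrow> nat" and a b
    using that by (intro card_mono) auto
  have below_less: "card (?below h a) < card (?below h b)"
    if "finite (range h)" "h a < h b" for h :: "'a \<Rightarrow> nat" and a b
  proof (rule psubset_card_mono)
    have "h a \<in> ?below h b" "h a \<notin> ?below h a" "?below h a \<subseteq> ?below h b" using that by auto
    then show "?below h a \<subset> ?below h b" by blast
  qed (use that in simp)
  have rank_less: "rank a < rank b" if "h a + k a < h b + k b" for a b
  proof -
    have "a \<le> b" using that h(1) k(1) by (meson add_mono linorder_le_cases monoD not_less)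
    then have "h a \<le> h b" "k a \<le> k b" using h(1) k(1) by (auto dest: monoD)
    moreover have "h a < h b \<or> k a < k b" using that by linarith
    ultimately show ?thesis unfolding rank_def
      using below_mono[OF h(2)] below_mono[OF k(2)] below_less[OF h(2)] below_less[OF k(2)]
      by (meson add_le_less_mono add_less_le_mono)
  qed
  have "rank a < card (range h) + card (range k)" for a
  proof -
    have "card (?below h a) < card (range h)" using h(2) by (intro psubset_card_mono) auto
    moreover have "card (?below k a) \<le> card (range k)" using k(2) by (intro card_mono) auto
    ultimately show ?thesis unfolding rank_def by linarith
  qed
  then have "(rank \<circ> pt) ` range (\<lambda>a. h a + k a) \<subseteq> {..<card (range h) + card (range k)}"
    by auto
  moreover have "inj_on (rank \<circ> pt) (range (\<lambda>a. h a + k a))"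
  proof (rule linorder_inj_onI')
    fix s t assume "s \<in> range (\<lambda>a. h a + k a)" "t \<in> range (\<lambda>a. h a + k a)" "s < t"
    then show "(rank \<circ> pt) s \<noteq> (rank \<circ> pt) t"
      using rank_less[of "pt s" "pt t"] pt by simp
  qed
  ultimately have "card (range (\<lambda>a. h a + k a)) \<le> card {..<card (range h) + card (range k)}"
    by (intro card_inj_on_le[of "rank \<circ> pt"]) simp_all
  then show ?thesis by simp
qed

lemma card_range_slope_plus:
  assumes "finite (dom f)" "dom f \<noteq> {}" "finite (dom g)" "dom g \<noteq> {}"
  shows "card (range (slope (trop_plus f g))) \<le> card (range (slope f)) + card (range (slope g))"
proof -
  have "card (range (slope (trop_plus f g))) \<le> card (range (slope f) \<union> range (slope g))"
    using assms by (intro card_mono range_slope_plus) (auto simp: finite_range_slope)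
  also have "\<dots> \<le> card (range (slope f)) + card (range (slope g))" by (rule card_Un_le)
  finally show ?thesis .
qed

lemma card_range_slope_times:
  assumes "finite (dom f)" "dom f \<noteq> {}" "finite (dom g)" "dom g \<noteq> {}"
  shows "card (range (slope (trop_times f g))) \<le> card (range (slope f)) + card (range (slope g))"
  using card_range_add_le[OF mono_slope finite_range_slope mono_slope finite_range_slope] assms
  by (simp add: slope_times)

lemma dom_singleton_map: "dom [i \<mapsto> c] = {i}"
  by simp

lemma card_range_slope_singleton: "card (range (slope [i \<mapsto> c])) = 1"
proof -
  have "slope [i \<mapsto> c] a = i" for a using slope_attains(1)[of "[i \<mapsto> c]" a] by simp
  then show ?thesis by simp
qed


section \<open>Subformulas\<close>

definition ancestors :: "('v, 'e) trop_circuit \<Rightarrow> 'v \<Rightarrow> 'v set" where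
  "ancestors C v = {u \<in> verts (dag C). (u, v) \<in> (arcs_ends (dag C))\<^sup>*}"

text \<open>
  As long as \<open>x\<close> has not been reached there is a single way on, so the path to \<open>y\<close> follows the path
  to \<open>x\<close> until one of them ends.
\<close>

lemma paths_comparable_if_deterministic:
  assumes "(u, x) \<in> r\<^sup>*" and "(u, y) \<in> r\<^sup>*"
    and "\<And>w p q. (w, x) \<in> r\<^sup>+ \<Longrightarrow> (w, p) \<in> r \<Longrightarrow> (w, q) \<in> r \<Longrightarrow> p = q"
  shows "(x, y) \<in> r\<^sup>* \<or> (y, x) \<in> r\<^sup>*"
  using assms(1,2)
proof (induction rule: converse_rtrancl_induct)
  case base
  then show ?case by simp
next
  case (step u w)
  note IH = step.IH
  from step.prems show ?case
  proof (cases rule: converse_rtranclE)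
    case base
    then show ?thesis using step.hyps by (blast intro: converse_rtrancl_into_rtrancl)
  next
    case (step w')
    then have "w' = w" using assms(3) \<open>(u, w) \<in> r\<close> \<open>(w, x) \<in> r\<^sup>*\<close> by (meson rtrancl_into_trancl2)
    then show ?thesis using IH \<open>(w', y) \<in> r\<^sup>*\<close> by simp
  qed
qed

lemma formula_arc_unique:
  assumes C: "tropical_formula K C"
    and d: "d \<in> arcs (dag C)" and e: "e \<in> arcs (dag C)" and "tail (dag C) d = tail (dag C) e"
    and reach: "(tail (dag C) d, output_gate C) \<in> (arcs_ends (dag C))\<^sup>+"
  shows "d = e"
proof -
  interpret fin_digraph "dag C"
    using C by (simp add: tropical_formula_def tropical_circuit_def)
  have "tail (dag C) d \<noteq> output_gate C"
    using C reach by (auto simp: tropical_formula_def tropical_circuit_def acyclic_def)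
  then have "card (out_arcs (dag C) (tail (dag C) d)) = 1"
    using C d by (simp add: tropical_formula_def out_degree_def)
  moreover have "d \<in> out_arcs (dag C) (tail (dag C) d)" "e \<in> out_arcs (dag C) (tail (dag C) d)"
    using assms by auto
  ultimately show ?thesis by (metis card_1_singletonE singletonD)
qed

text \<open>
  A common ancestor of both inputs would make one input, say the tail of \<open>d\<close>, an ancestor of the
  other. They are different gates, as \<open>d\<close> is the only arc that leaves the tail of \<open>d\<close>; so the way
  from one to the other starts with \<open>d\<close> and passes through \<open>v\<close>, and \<open>v\<close> would lie on a cycle.
\<close>

lemma disjoint_ancestors:
  assumes C: "tropical_formula K C" and reach: "(v, output_gate C) \<in> (arcs_ends (dag C))\<^sup>*"
    and de: "in_arcs (dag C) v = {d, e}" "d \<noteq> e"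
  shows "ancestors C (tail (dag C) d) \<inter> ancestors C (tail (dag C) e) = {}"
proof (rule ccontr)
  let ?A = "arcs_ends (dag C)" and ?t = "tail (dag C)"
  have acyc: "acyclic ?A" using C by (simp add: tropical_formula_def tropical_circuit_def)
  have in_v: "b \<in> arcs (dag C) \<and> head (dag C) b = v" if "b \<in> {d, e}" for b
    using de that unfolding in_arcs_def by blast
  then have arc: "(?t b, v) \<in> ?A" if "b \<in> {d, e}" for b
    using that by (force simp: arcs_ends_conv)
  have out: "(?t b, output_gate C) \<in> ?A\<^sup>+" if "b \<in> {d, e}" for b
    using arc[OF that] reach by (rule rtrancl_into_trancl2)
  have no_path: "(?t b, ?t b') \<notin> ?A\<^sup>*" if b: "b \<in> {d, e}" "b' \<in> {d, e}" "b \<noteq> b'" for b b'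
  proof
    assume "(?t b, ?t b') \<in> ?A\<^sup>*"
    then show False
    proof (cases rule: converse_rtranclE)
      case base
      then show False using formula_arc_unique[OF C, of b b'] in_v out b by blast
    next
      case (step w)
      then obtain c where c: "c \<in> arcs (dag C)" "?t c = ?t b" "head (dag C) c = w"
        by (auto simp: arcs_ends_conv)
      then have "b = c" using formula_arc_unique[OF C, of b c] in_v out b by auto
      then have "w = v" using c in_v b by auto
      then have "(v, v) \<in> ?A\<^sup>+" using step arc b by (blast intro: rtrancl_into_trancl1)
      then show False using acyc by (auto simp: acyclic_def)
    qed
  qed
  have det: "p = q" if w: "(w, ?t d) \<in> ?A\<^sup>+" "(w, p) \<in> ?A" "(w, q) \<in> ?A" for w p q
  proof -
    have "(w, output_gate C) \<in> ?A\<^sup>+" using w(1) out by (blast intro: trancl_trans)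
    then show ?thesis
      using w(2,3) formula_arc_unique[OF C] by (fastforce simp: arcs_ends_conv)
  qed
  assume "ancestors C (?t d) \<inter> ancestors C (?t e) \<noteq> {}"
  then obtain u where "(u, ?t d) \<in> ?A\<^sup>*" "(u, ?t e) \<in> ?A\<^sup>*" by (auto simp: ancestors_def)
  then have "(?t d, ?t e) \<in> ?A\<^sup>* \<or> (?t e, ?t d) \<in> ?A\<^sup>*"
    by (rule paths_comparable_if_deterministic) (rule det)
  then show False using no_path de(2) by blast
qed

lemma card_ancestors_inputs:
  assumes C: "tropical_formula K C" and reach: "(v, output_gate C) \<in> (arcs_ends (dag C))\<^sup>*"
    and de: "in_arcs (dag C) v = {d, e}" "d \<noteq> e"
  shows "card (ancestors C (tail (dag C) d)) + card (ancestors C (tail (dag C) e))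
      \<le> card (ancestors C v)"
    and "(tail (dag C) d, output_gate C) \<in> (arcs_ends (dag C))\<^sup>*"
    and "(tail (dag C) e, output_gate C) \<in> (arcs_ends (dag C))\<^sup>*"
proof -
  let ?A = "arcs_ends (dag C)" and ?t = "tail (dag C)"
  interpret fin_digraph "dag C"
    using C by (simp add: tropical_formula_def tropical_circuit_def)
  have fin: "finite (ancestors C w)" for w by (simp add: ancestors_def)
  have "b \<in> arcs (dag C) \<and> head (dag C) b = v" if "b \<in> {d, e}" for b
    using de that unfolding in_arcs_def by blast
  then have arc: "(?t d, v) \<in> ?A" "(?t e, v) \<in> ?A" by (force simp: arcs_ends_conv)+
  then show "(?t d, output_gate C) \<in> ?A\<^sup>*" "(?t e, output_gate C) \<in> ?A\<^sup>*"
    using reach by (auto intro: converse_rtrancl_into_rtrancl)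
  have "ancestors C (?t d) \<union> ancestors C (?t e) \<subseteq> ancestors C v"
    using arc by (auto simp: ancestors_def intro: rtrancl_into_rtrancl)
  then have "card (ancestors C (?t d) \<union> ancestors C (?t e)) \<le> card (ancestors C v)"
    by (rule card_mono[OF fin])
  then show "card (ancestors C (?t d)) + card (ancestors C (?t e)) \<le> card (ancestors C v)"
    using disjoint_ancestors[OF assms] fin by (simp add: card_Un_disjoint)
qed

lemma card_ancestors_pos:
  assumes "tropical_formula K C" "v \<in> verts (dag C)"
  shows "1 \<le> card (ancestors C v)"
proof -
  interpret fin_digraph "dag C"
    using assms by (simp add: tropical_formula_def tropical_circuit_def)
  have "v \<in> ancestors C v" "finite (ancestors C v)" using assms by (auto simp: ancestors_def)
  then show ?thesis by (metis One_nat_def Suc_leI card_gt_0_iff empty_iff)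
qed

text \<open>
  The restriction to gates from which the output is reachable is what makes the two inputs of the
  gate differ from the output, and so have a single outgoing arc.
\<close>

lemma card_range_slope_le_ancestors:
  assumes C: "tropical_formula K C" and "gate_computes C v f"
    and "(v, output_gate C) \<in> (arcs_ends (dag C))\<^sup>*"
  shows "finite (dom f) \<and> dom f \<noteq> {} \<and> card (range (slope f)) \<le> card (ancestors C v)"
  using assms(2,3)
proof (induction rule: gate_computes.induct)
  case (var v)
  then show ?case
    using card_ancestors_pos[OF C var.hyps(1)]
    unfolding trop_var_def dom_singleton_map card_range_slope_singleton by simp
next
  case (const v c)
  then show ?case
    using card_ancestors_pos[OF C const.hyps(1)]
    unfolding trop_const_def dom_singleton_map card_range_slope_singleton by simp
next
  case (oplus v d e f g)
  note inputs = card_ancestors_inputs[OF C oplus.prems oplus.hyps(3,4)]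
  have f: "finite (dom f)" "dom f \<noteq> {}" "card (range (slope f)) \<le> card (ancestors C (tail (dag C) d))"
    and g: "finite (dom g)" "dom g \<noteq> {}" "card (range (slope g)) \<le> card (ancestors C (tail (dag C) e))"
    using oplus.IH inputs by auto
  then show ?case
    using inputs(1) card_range_slope_plus[OF f(1,2) g(1,2)] by (auto simp: dom_trop_plus)
next
  case (odot v d e f g)
  note inputs = card_ancestors_inputs[OF C odot.prems odot.hyps(3,4)]
  have f: "finite (dom f)" "dom f \<noteq> {}" "card (range (slope f)) \<le> card (ancestors C (tail (dag C) d))"
    and g: "finite (dom g)" "dom g \<noteq> {}" "card (range (slope g)) \<le> card (ancestors C (tail (dag C) e))"
    using odot.IH inputs by auto
  have "finite (dom (trop_times f g))" using f g by (simp add: dom_trop_times finite_image_set2)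
  moreover have "dom (trop_times f g) \<noteq> {}" using f(2) g(2) unfolding dom_trop_times by blast
  ultimately show ?case
    using f(3) g(3) inputs(1) card_range_slope_times[OF f(1,2) g(1,2)] by simp
qed

theorem lemma24:
  fixes K :: "real set" and C :: "('v, 'e) trop_circuit" and f :: trop_poly
  assumes "K = \<real> \<or> K = \<rat>"
    and "tropical_polynomial K f"
    and "tropical_formula K C"
    and "circuit_computes C f"
  shows "finite (trop_roots K f) \<and> card (trop_roots K f) \<le> circuit_size C"
proof -
  interpret fin_digraph "dag C"
    using assms(3) by (simp add: tropical_formula_def tropical_circuit_def)
  have f: "finite (dom f)" "dom f \<noteq> {}"
    and slopes: "card (range (slope f)) \<le> card (ancestors C (output_gate C))"
    using card_range_slope_le_ancestors[OF assms(3)] assms(4)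
    by (auto simp: circuit_computes_def)
  have "card (trop_roots K f) < card (range (slope f))" by (rule card_trop_roots_less(2)[OF f])
  also have "\<dots> \<le> card (ancestors C (output_gate C))" by (rule slopes)
  also have "\<dots> \<le> circuit_size C"
    unfolding circuit_size_def ancestors_def by (intro card_mono) auto
  finally show ?thesis using card_trop_roots_less(1)[OF f] by auto
qed

end
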